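(* Let $G$ be a Cameron--Walker graph whose supporting connected bipartite graph is a complete bipartite graph $K_{n,m}$. Then \[ \mathcal{F}_\emptyset,\mathcal{F}_{\{1\}},\mathcal{F}_{\{2\}},\dots,\mathcal{F}_{[m']},\mathcal{G}_{\{1\}},\mathcal{G}_{\{2\}},\dots,\mathcal{G}_{[n]} \] is a shelling of $\Delta(\overline{G})$, where the families $\mathcal{F}_I$ ($I\subset[m']$) are listed first, in decreasing order of $I$, followed by the families $\mathcal{G}_J$ ($\emptyset\neq J\subset[n]$), in decreasing order of $J$, with respect to the total order on index sets defined in the context, and within each family $\mathcal{F}_I=\{F_\nu\}$ or $\mathcal{G}_J=\{G_\nu\}$ the facets are listed in decreasing order of the sign vector $\nu$ with respect to the total order on sign vectors defined in the context.
   Context: All graphs are finite and simple. A Cameron--Walker graph is a finite connected simple graph $G$ whose maximum induced matching size $im(G)$ equals its maximum matching size $m(G)$ and which is neither a star nor a star triangle (a star triangle is some number of triangles joined at one common vertex). Such a graph consists of a connected bipartite graph (the supporting connected bipartite graph) with vertex partition $[n]\sqcup[m]$, together with at least one leaf (vertex of degree $1$) attached to each vertex $i\in[n]$ and possibly some (zero or more) pendant triangles attached to each vertex $j\in[m]$ (a pendant triangle at $j$ consists of $j$ and two further vertices of degree $2$ adjacent to each other and to $j$). Notation when the supporting bipartite graph is $K_{n,m}$. Its parts are $\{x_1,\ldots,x_n\}$ and $\{y_1,\ldots,y_m\}$. The leaves attached to $x_k$ are $z_{k,1},\ldots,z_{k,f_k}$ with $f_k\geq1$. There are $t_j\geq0$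 pendant triangles attached to $y_j$; the two degree-$2$ vertices of the $l$-th triangle at $y_j$ are $w_{j,l}^{+}$ and $w_{j,l}^{-}$ ($1\le l\le t_j$). Let $t=\sum_j t_j$, let $m'\leq m$ be the number of $j$ with $t_j\geq1$, and label the vertices so that $t_j\ge 1$ for $j\leq m'$ and $t_j=0$ for $j>m'$. $\Delta(\overline G)$ is the clique complex of the complementary graph, i.e. the simplicial complex of independent sets of $G$. Its facets form the following families. For $I\subset[m']$, let $s_I=\sum_{i\in[m']\setminus I}t_i$. $\mathcal{F}_I=\{F_\nu : \nu\in\{+,-\}^{s_I}\}$ is the family of sets \[ \{y_{m'+1},\dots,y_m\}\cup\{z_{k,l} : 1\leq k\leq n,\ 1\leq l\leq f_k\}\cup\{y_i : i\in I\}\cup\{w_{i',j}^{\epsilon_{i',j}} : i'\in[m']\setminus I,\ 1\leq j\leq t_{i'}\}, \] with $\epsilon_{i',j}\in\{+,-\}$, where $\nu$ is the vector of signs $(\epsilon_{i',j})$ (with respect to a fixed ordering of the index pairs $(i',j)$). For $\emptyset\neq J\subset[n]$, $\mathcal{G}_J=\{G_\nu : \nu\in\{+,-\}^{t}\}$ is the family of sets \[ \{x_j : j\in J\}\cup\{z_{j',i} : j'\in[n]\setminus J,\ 1\leq i\leq f_{j'}\}\cup\{w_{k,l}^{\epsilon_{k,l}} : 1\leq k\leq m',\ 1\leq l\leq t_k\}, \] with $\epsilon_{k,l}\in\{+,-\}$, where $\nu$ is the vector of signs $(\epsilon_{k,l})$ (with respect to a fixed ordering of the index pairs). Order on sign vectors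 of a fixed length: let $\nu_+$ be the number of $+$'s in $\nu$ and $\nu^{(k)}$ its $k$-th entry. Then $\nu<\omega$ iff either $\nu_+<\omega_+$, or $\nu_+=\omega_+$, $\nu^{(d)}=+$ and $\omega^{(d)}=-$, where $d$ is the first position from the left in which $\nu$ and $\omega$ differ. Order on index sets: for $I,L\subset[m']$, $L<I$ iff either $|I|<|L|$, or $|I|=|L|$ and the first nonzero entry (from the left) of $\sum_{i\in I}\mathbf{e}_i-\sum_{l\in L}\mathbf{e}_l$ is $1$, where $\mathbf{e}_i$ are the standard basis vectors of $\mathbb{R}^{m'}$. The order on nonempty subsets $J\subset[n]$ is defined in the same way in $\mathbb{R}^n$. A shelling of a (not necessarily pure) simplicial complex is a listing $F_1,\ldots,F_s$ of all its facets such that $\left(\bigcup_{j=1}^{i-1}\langle F_j\rangle\right)\cap\langle F_i\rangle$ is a pure simplicial complex of dimension $\dim F_i-1$ for every $1<i\leq s$, where $\langle F\rangle=\{\sigma : \sigma\subset F\}$. *)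

theory Defs
  imports Complex_Main "Graph_Theory.Graph_Theory"
begin

section \<open>Finite simple graphs and Cameron--Walker graphs\<close>

text \<open>
  A finite simple graph is a \<^typ>\<open>'a pair_pre_digraph\<close> satisfying \<^const>\<open>pair_graph\<close>: finite,
  loopless, and with a symmetric arc relation.
\<close>

definition edges :: "'a pair_pre_digraph \<Rightarrow> 'a set set" where
  "edges G = {{u, v} | u v. (u, v) \<in> parcs G}"

definition matching :: "'a pair_pre_digraph \<Rightarrow> 'a set set \<Rightarrow> bool" where
  "matching G M \<longleftrightarrow> M \<subseteq> edges G \<and> (\<forall>e\<in>M. \<forall>e'\<in>M. e \<noteq> e' \<longrightarrow> e \<inter> e' = {})"

definition induced_matching :: "'a pair_pre_digraph \<Rightarrow> 'a set set \<Rightarrow> bool" where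
  "induced_matching G M \<longleftrightarrow> matching G M \<and>
     (\<forall>e\<in>M. \<forall>e'\<in>M. e \<noteq> e' \<longrightarrow> (\<forall>u\<in>e. \<forall>v\<in>e'. (u, v) \<notin> parcs G))"

definition matching_number :: "'a pair_pre_digraph \<Rightarrow> nat" where
  "matching_number G = Max (card ` {M. matching G M})"

definition induced_matching_number :: "'a pair_pre_digraph \<Rightarrow> nat" where
  "induced_matching_number G = Max (card ` {M. induced_matching G M})"

definition is_star :: "'a pair_pre_digraph \<Rightarrow> bool" where
  "is_star G \<longleftrightarrow> (\<exists>c\<in>pverts G. edges G = {{c, v} | v. v \<in> pverts G - {c}})"

text \<open>\<open>P\<close> is the set of the bases (the sides opposite to the common vertex \<open>c\<close>) of the triangles.\<close>

definition is_star_triangle :: "'a pair_pre_digraph \<Rightarrow> bool" where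
  "is_star_triangle G \<longleftrightarrow> (\<exists>c P.
     (\<forall>p\<in>P. card p = 2 \<and> c \<notin> p) \<and> (\<forall>p\<in>P. \<forall>q\<in>P. p \<noteq> q \<longrightarrow> p \<inter> q = {}) \<and>
     pverts G = insert c (\<Union>P) \<and> edges G = P \<union> {{c, v} | v. v \<in> \<Union>P})"

definition Cameron_Walker :: "'a pair_pre_digraph \<Rightarrow> bool" where
  "Cameron_Walker G \<longleftrightarrow> pair_graph G \<and> connected (with_proj G) \<and>
     induced_matching_number G = matching_number G \<and> \<not> is_star G \<and> \<not> is_star_triangle G"


section \<open>Labelled vertices of a Cameron--Walker graph\<close>

datatype sign = Plus | Minus

text \<open>
  \<open>Xv k\<close>, \<open>Yv j\<close>, \<open>Zv k l\<close> and \<open>Wv \<epsilon> j l\<close> are the labels of $x_k$, $y_j$, $z_{k,l}$ and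
  $w_{j,l}^{\epsilon}$; all indices are counted from 1.
\<close>

datatype cw_label = Xv nat | Yv nat | Zv nat nat | Wv sign nat nat

text \<open>
  \<open>cw_graph n m B f t\<close> is the graph obtained from the bipartite graph with parts
  $x_1,\ldots,x_n$ and $y_1,\ldots,y_m$ and edges $x_k y_j$ for \<open>(k, j) \<in> B\<close> by attaching
  \<open>f k\<close> leaves to each $x_k$ and \<open>t j\<close> pendant triangles to each $y_j$.
\<close>

definition cw_verts :: "nat \<Rightarrow> nat \<Rightarrow> (nat \<Rightarrow> nat) \<Rightarrow> (nat \<Rightarrow> nat) \<Rightarrow> cw_label set" where
  "cw_verts n m f t =
     {Xv k | k. k \<in> {1..n}} \<union> {Yv j | j. j \<in> {1..m}} \<union>
     {Zv k l | k l. k \<in> {1..n} \<and> l \<in> {1..f k}} \<union>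
     {Wv e j l | e j l. j \<in> {1..m} \<and> l \<in> {1..t j}}"

definition cw_half_arcs ::
    "nat \<Rightarrow> nat \<Rightarrow> (nat \<times> nat) set \<Rightarrow> (nat \<Rightarrow> nat) \<Rightarrow> (nat \<Rightarrow> nat) \<Rightarrow> (cw_label \<times> cw_label) set" where
  "cw_half_arcs n m B f t =
     {(Xv k, Yv j) | k j. (k, j) \<in> B} \<union>
     {(Xv k, Zv k l) | k l. k \<in> {1..n} \<and> l \<in> {1..f k}} \<union>
     {(Yv j, Wv e j l) | e j l. j \<in> {1..m} \<and> l \<in> {1..t j}} \<union>
     {(Wv Plus j l, Wv Minus j l) | j l. j \<in> {1..m} \<and> l \<in> {1..t j}}"

definition cw_graph ::
    "nat \<Rightarrow> nat \<Rightarrow> (nat \<times> nat) set \<Rightarrow> (nat \<Rightarrow> nat) \<Rightarrow> (nat \<Rightarrow> nat) \<Rightarrow> cw_label pair_pre_digraph" where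
  "cw_graph n m B f t =
     \<lparr>pverts = cw_verts n m f t, parcs = cw_half_arcs n m B f t \<union> (cw_half_arcs n m B f t)\<inverse>\<rparr>"

definition complete_bipartite_edges :: "nat \<Rightarrow> nat \<Rightarrow> (nat \<times> nat) set" where
  "complete_bipartite_edges n m = {1..n} \<times> {1..m}"

definition graph_isomorphism ::
    "('a \<Rightarrow> 'b) \<Rightarrow> 'a pair_pre_digraph \<Rightarrow> 'b pair_pre_digraph \<Rightarrow> bool" where
  "graph_isomorphism h H G \<longleftrightarrow> bij_betw h (pverts H) (pverts G) \<and>
     (\<forall>u\<in>pverts H. \<forall>v\<in>pverts H. (u, v) \<in> parcs H \<longleftrightarrow> (h u, h v) \<in> parcs G)"


section \<open>Simplicial complexes and shellings\<close>

definition complement_graph :: "'a pair_pre_digraph \<Rightarrow> 'a pair_pre_digraph" where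
  "complement_graph G = \<lparr>pverts = pverts G,
     parcs = {(u, v). u \<in> pverts G \<and> v \<in> pverts G \<and> u \<noteq> v \<and> (u, v) \<notin> parcs G}\<rparr>"

definition clique_complex :: "'a pair_pre_digraph \<Rightarrow> 'a set set" where
  "clique_complex G = {\<sigma>. finite \<sigma> \<and> \<sigma> \<subseteq> pverts G \<and> (\<forall>u\<in>\<sigma>. \<forall>v\<in>\<sigma>. u \<noteq> v \<longrightarrow> (u, v) \<in> parcs G)}"

definition facets :: "'a set set \<Rightarrow> 'a set set" where
  "facets K = {F \<in> K. \<forall>\<sigma>\<in>K. F \<subseteq> \<sigma> \<longrightarrow> \<sigma> = F}"

text \<open>The empty face has dimension $-1$.\<close>

definition face_dim :: "'a set \<Rightarrow> int" where
  "face_dim \<sigma> = int (card \<sigma>) - 1"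

definition simplicial_complex :: "'a set set \<Rightarrow> bool" where
  "simplicial_complex K \<longleftrightarrow> finite K \<and> K \<noteq> {} \<and>
     (\<forall>\<sigma>\<in>K. finite \<sigma> \<and> (\<forall>\<tau>. \<tau> \<subseteq> \<sigma> \<longrightarrow> \<tau> \<in> K))"

definition complex_dim :: "'a set set \<Rightarrow> int" where
  "complex_dim K = Max (face_dim ` K)"

definition pure_complex :: "'a set set \<Rightarrow> bool" where
  "pure_complex K \<longleftrightarrow> simplicial_complex K \<and> (\<forall>F\<in>facets K. face_dim F = complex_dim K)"

text \<open>The list is indexed from 0, and \<^term>\<open>Pow F\<close> is the complex $\langle F\rangle$.\<close>

definition shelling :: "'a set set \<Rightarrow> 'a set list \<Rightarrow> bool" where
  "shelling K Fs \<longleftrightarrow> simplicial_complex K \<and> distinct Fs \<and> set Fs = facets K \<and>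
     (\<forall>i. 0 < i \<and> i < length Fs \<longrightarrow>
        (let L = (\<Union>j<i. Pow (Fs ! j)) \<inter> Pow (Fs ! i)
         in pure_complex L \<and> complex_dim L = face_dim (Fs ! i) - 1))"


section \<open>The orders on sign vectors and on index sets\<close>

definition sign_less :: "sign list \<Rightarrow> sign list \<Rightarrow> bool" where
  "sign_less \<nu> \<omega> \<longleftrightarrow> count_list \<nu> Plus < count_list \<omega> Plus \<or>
     (count_list \<nu> Plus = count_list \<omega> Plus \<and>
      (\<exists>d<length \<nu>. (\<forall>k<d. \<nu> ! k = \<omega> ! k) \<and> \<nu> ! d = Plus \<and> \<omega> ! d = Minus))"

definition sign_vectors :: "nat \<Rightarrow> sign list set" where
  "sign_vectors s = {\<nu>. length \<nu> = s}"

text \<open>Vectors of $\mathbb{R}^r$ are functions \<^typ>\<open>nat \<Rightarrow> real\<close> used on the coordinates \<open>1, \<dots>, r\<close>.\<close>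

definition std_basis :: "nat \<Rightarrow> nat \<Rightarrow> real" where
  "std_basis i k = (if k = i then 1 else 0)"

definition first_nonzero_is_one :: "nat \<Rightarrow> (nat \<Rightarrow> real) \<Rightarrow> bool" where
  "first_nonzero_is_one r v \<longleftrightarrow> (\<exists>d\<in>{1..r}. (\<forall>k\<in>{1..<d}. v k = 0) \<and> v d = 1)"

text \<open>\<open>index_less r L I\<close> is $L < I$ for subsets of $\{1,\ldots,r\}$; smaller sets are larger.\<close>

definition index_less :: "nat \<Rightarrow> nat set \<Rightarrow> nat set \<Rightarrow> bool" where
  "index_less r L I \<longleftrightarrow> card I < card L \<or>
     (card I = card L \<and>
      first_nonzero_is_one r (\<lambda>k. (\<Sum>i\<in>I. std_basis i k) - (\<Sum>l\<in>L. std_basis l k)))"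

definition is_decreasing_listing :: "('a \<Rightarrow> 'a \<Rightarrow> bool) \<Rightarrow> 'a set \<Rightarrow> 'a list \<Rightarrow> bool" where
  "is_decreasing_listing lt A xs \<longleftrightarrow>
     distinct xs \<and> set xs = A \<and> sorted_wrt (\<lambda>a b. lt b a) xs"

definition decreasing_listing :: "('a \<Rightarrow> 'a \<Rightarrow> bool) \<Rightarrow> 'a set \<Rightarrow> 'a list" where
  "decreasing_listing lt A = (THE xs. is_decreasing_listing lt A xs)"

text \<open>The description is proper whenever \<open>lt\<close> is a strict total order on a finite \<open>A\<close>, which
  is shown below for sign vectors of a fixed length and for subsets of $\{1,\ldots,r\}$.\<close>

lemma is_decreasing_listing_unique:
  assumes "asymp_on A lt" "is_decreasing_listing lt A xs" "is_decreasing_listing lt A ys"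
  shows "xs = ys"
  using assms
proof (induction xs arbitrary: A ys)
  case Nil
  then show ?case by (auto simp: is_decreasing_listing_def)
next
  case (Cons x xs)
  then obtain y zs where ys: "ys = y # zs"
    by (cases ys) (auto simp: is_decreasing_listing_def)
  have "x = y"
  proof (rule ccontr)
    assume "x \<noteq> y"
    then have "y \<in> set xs" "x \<in> set zs" using Cons.prems ys
      by (auto simp: is_decreasing_listing_def)
    then have "lt y x" "lt x y" "x \<in> A" "y \<in> A" using Cons.prems ys
      by (auto simp: is_decreasing_listing_def)
    then show False using Cons.prems(1) by (auto dest: asymp_onD)
  qed
  moreover have "xs = zs"
  proof (rule Cons.IH)
    show "asymp_on (A - {x}) lt" using Cons.prems(1) by (auto intro: asymp_on_subset)
  qed (use Cons.prems ys \<open>x = y\<close> in \<open>auto simp: is_decreasing_listing_def\<close>)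
  ultimately show ?case using ys by simp
qed

lemma is_decreasing_listing_exists:
  assumes "finite A" "asymp_on A lt" "transp_on A lt" "totalp_on A lt"
  shows "\<exists>xs. is_decreasing_listing lt A xs"
  using assms
proof (induction "card A" arbitrary: A)
  case 0
  then show ?case by (intro exI[of _ "[]"]) (auto simp: is_decreasing_listing_def)
next
  case (Suc n)
  then have "A \<noteq> {}" by auto
  obtain a where a: "a \<in> A" "\<forall>x\<in>A. x \<noteq> a \<longrightarrow> \<not> lt a x"
    using Finite_Set.bex_max_element[OF Suc.prems(1,2,3) \<open>A \<noteq> {}\<close>] by blast
  have "\<exists>xs. is_decreasing_listing lt (A - {a}) xs"
  proof (rule Suc.hyps(1))
    show "n = card (A - {a})" using Suc.hyps(2) a(1) Suc.prems(1) by simp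
    show "asymp_on (A - {a}) lt" "transp_on (A - {a}) lt" "totalp_on (A - {a}) lt"
      using Suc.prems by (auto intro: asymp_on_subset transp_on_subset totalp_on_subset)
  qed (use Suc.prems in auto)
  then obtain xs where "is_decreasing_listing lt (A - {a}) xs" by blast
  then have "is_decreasing_listing lt A (a # xs)"
    using a Suc.prems(4) by (auto simp: is_decreasing_listing_def totalp_on_def)
  then show ?case by blast
qed

lemma is_decreasing_listing_decreasing_listing:
  assumes "finite A" "asymp_on A lt" "transp_on A lt" "totalp_on A lt"
  shows "is_decreasing_listing lt A (decreasing_listing lt A)"
  unfolding decreasing_listing_def
  using is_decreasing_listing_exists[OF assms] is_decreasing_listing_unique[OF assms(2)]
  by (metis (no_types, lifting) theI')

lemma sign_less_order:
  "asymp_on (sign_vectors s) sign_less" "transp_on (sign_vectors s) sign_less"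
  "totalp_on (sign_vectors s) sign_less" "finite (sign_vectors s)"
proof -
  show "asymp_on (sign_vectors s) sign_less"
  proof (rule asymp_onI)
    fix \<nu> \<omega> assume "\<nu> \<in> sign_vectors s" "\<omega> \<in> sign_vectors s" "sign_less \<nu> \<omega>"
    then show "\<not> sign_less \<omega> \<nu>"
    proof (cases "count_list \<nu> Plus = count_list \<omega> Plus")
      case True
      obtain d where d: "\<forall>k<d. \<nu> ! k = \<omega> ! k" "\<nu> ! d = Plus" "\<omega> ! d = Minus"
        using \<open>sign_less \<nu> \<omega>\<close> True unfolding sign_less_def by auto
      show ?thesis
      proof
        assume "sign_less \<omega> \<nu>"
        then obtain e where e: "\<forall>k<e. \<omega> ! k = \<nu> ! k" "\<omega> ! e = Plus" "\<nu> ! e = Minus"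
          using True unfolding sign_less_def by auto
        show False using d e by (cases d e rule: linorder_cases) auto
      qed
    qed (auto simp: sign_less_def)
  qed
  show "transp_on (sign_vectors s) sign_less"
  proof (rule transp_onI)
    fix \<nu> \<omega> \<rho> assume len: "\<nu> \<in> sign_vectors s" "\<omega> \<in> sign_vectors s" "\<rho> \<in> sign_vectors s"
      and l: "sign_less \<nu> \<omega>" "sign_less \<omega> \<rho>"
    show "sign_less \<nu> \<rho>"
    proof (cases "count_list \<nu> Plus = count_list \<omega> Plus \<and> count_list \<omega> Plus = count_list \<rho> Plus")
      case True
      obtain d where d: "d < length \<nu>" "\<forall>k<d. \<nu> ! k = \<omega> ! k" "\<nu> ! d = Plus" "\<omega> ! d = Minus"
        using l(1) True unfolding sign_less_def by auto
      obtain e where e: "e < length \<omega>" "\<forall>k<e. \<omega> ! k = \<rho> ! k" "\<omega> ! e = Plus" "\<rho> ! e = Minus"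
        using l(2) True unfolding sign_less_def by auto
      have "d \<noteq> e" using d e by auto
      then have "\<exists>c<length \<nu>. (\<forall>k<c. \<nu> ! k = \<rho> ! k) \<and> \<nu> ! c = Plus \<and> \<rho> ! c = Minus"
        using d e len by (intro exI[of _ "min d e"]) (auto simp: min_def sign_vectors_def)
      then show ?thesis using True unfolding sign_less_def by auto
    next
      case False
      then show ?thesis using l unfolding sign_less_def by auto
    qed
  qed
  show "totalp_on (sign_vectors s) sign_less"
  proof (rule totalp_onI)
    fix \<nu> \<omega> assume len: "\<nu> \<in> sign_vectors s" "\<omega> \<in> sign_vectors s" and ne: "\<nu> \<noteq> \<omega>"
    define d where "d = (LEAST k. \<nu> ! k \<noteq> \<omega> ! k)"
    obtain k where k: "k < s" "\<nu> ! k \<noteq> \<omega> ! k"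
      using len ne by (auto simp: sign_vectors_def list_eq_iff_nth_eq)
    have d1: "\<nu> ! d \<noteq> \<omega> ! d"
      unfolding d_def by (rule LeastI[of "\<lambda>k. \<nu> ! k \<noteq> \<omega> ! k", OF k(2)])
    have "d \<le> k" unfolding d_def by (rule Least_le[of "\<lambda>k. \<nu> ! k \<noteq> \<omega> ! k", OF k(2)])
    then have d2: "d < s" using k(1) by simp
    have d3: "\<forall>k<d. \<nu> ! k = \<omega> ! k"
      unfolding d_def by (blast dest: not_less_Least)
    note d = d1 d2 d3
    have "\<nu> ! d = Plus \<and> \<omega> ! d = Minus \<or> \<nu> ! d = Minus \<and> \<omega> ! d = Plus"
      using d(1) by (metis sign.exhaust)
    then have "(\<exists>d<length \<nu>. (\<forall>k<d. \<nu> ! k = \<omega> ! k) \<and> \<nu> ! d = Plus \<and> \<omega> ! d = Minus) \<or>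
        (\<exists>d<length \<omega>. (\<forall>k<d. \<omega> ! k = \<nu> ! k) \<and> \<omega> ! d = Plus \<and> \<nu> ! d = Minus)"
    proof
      assume "\<nu> ! d = Plus \<and> \<omega> ! d = Minus"
      then show ?thesis using d len
        by (intro disjI1 exI[of _ d]) (simp add: sign_vectors_def)
    next
      assume "\<nu> ! d = Minus \<and> \<omega> ! d = Plus"
      then show ?thesis using d len
        by (intro disjI2 exI[of _ d]) (simp add: sign_vectors_def)
    qed
    then show "sign_less \<nu> \<omega> \<or> sign_less \<omega> \<nu>"
      unfolding sign_less_def by (meson linorder_neqE_nat)
  qed
  have "(UNIV :: sign set) = {Plus, Minus}" using sign.exhaust by auto
  then have "finite (UNIV :: sign set)" by (metis finite.emptyI finite_insert)
  then show "finite (sign_vectors s)"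
    using finite_lists_length_eq[of "UNIV :: sign set" s] by (simp add: sign_vectors_def)
qed

lemma index_less_iff:
  assumes "finite I" "finite L"
  shows "index_less r L I \<longleftrightarrow> card I < card L \<or>
    (card I = card L \<and> (\<exists>d\<in>{1..r}. (\<forall>k\<in>{1..<d}. k \<in> I \<longleftrightarrow> k \<in> L) \<and> d \<in> I \<and> d \<notin> L))"
proof -
  have e: "(\<Sum>i\<in>S. std_basis i k) = (if k \<in> S then 1 else 0)" if "finite S" for S k
    using that unfolding std_basis_def by simp
  show ?thesis
    unfolding index_less_def first_nonzero_is_one_def e[OF assms(1)] e[OF assms(2)] by auto
qed

lemma index_less_order:
  assumes "A \<subseteq> Pow {1..r}"
  shows "asymp_on A (index_less r)" "transp_on A (index_less r)"
    "totalp_on A (index_less r)" "finite A"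
proof -
  show "finite A" using assms by (rule finite_subset) simp
  have fin: "finite I" if "I \<in> A" for I
    using that assms finite_subset[of I "{1..r}"] by blast
  show "asymp_on A (index_less r)"
  proof (rule asymp_onI)
    fix L I assume A: "L \<in> A" "I \<in> A" and l: "index_less r L I"
    note iff = index_less_iff[OF fin[OF A(1)] fin[OF A(2)]] index_less_iff[OF fin[OF A(2)] fin[OF A(1)]]
    show "\<not> index_less r I L"
    proof (cases "card I = card L")
      case True
      obtain d where d: "d \<in> {1..r}" "\<forall>k\<in>{1..<d}. k \<in> I \<longleftrightarrow> k \<in> L" "d \<in> I" "d \<notin> L"
        using l True iff by auto
      show ?thesis
      proof
        assume "index_less r I L"
        then obtain e where e: "e \<in> {1..r}" "\<forall>k\<in>{1..<e}. k \<in> L \<longleftrightarrow> k \<in> I" "e \<in> L" "e \<notin> I"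
          using True iff by auto
        show False using d e by (cases d e rule: linorder_cases) auto
      qed
    next
      case False
      then show ?thesis using l iff by auto
    qed
  qed
  show "transp_on A (index_less r)"
  proof (rule transp_onI)
    fix K L I assume A: "K \<in> A" "L \<in> A" "I \<in> A" and l: "index_less r K L" "index_less r L I"
    note iff = index_less_iff[OF fin[OF A(2)] fin[OF A(1)]] index_less_iff[OF fin[OF A(3)] fin[OF A(2)]]
      index_less_iff[OF fin[OF A(3)] fin[OF A(1)]]
    show "index_less r K I"
    proof (cases "card K = card L \<and> card L = card I")
      case True
      obtain d where d: "d \<in> {1..r}" "\<forall>k\<in>{1..<d}. k \<in> L \<longleftrightarrow> k \<in> K" "d \<in> L" "d \<notin> K"
        using l(1) True A iff by auto
      obtain e where e: "e \<in> {1..r}" "\<forall>k\<in>{1..<e}. k \<in> I \<longleftrightarrow> k \<in> L" "e \<in> I" "e \<notin> L"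
        using l(2) True A iff by auto
      have "d \<noteq> e" using d e by auto
      then have "\<exists>c\<in>{1..r}. (\<forall>k\<in>{1..<c}. k \<in> I \<longleftrightarrow> k \<in> K) \<and> c \<in> I \<and> c \<notin> K"
        using d e by (intro bexI[of _ "min d e"]) (auto simp: min_def)
      then show ?thesis using True A iff by auto
    next
      case False
      then show ?thesis using l A iff by auto
    qed
  qed
  show "totalp_on A (index_less r)"
  proof (rule totalp_onI)
    fix L I assume A: "L \<in> A" "I \<in> A" and ne: "L \<noteq> I"
    define d where "d = (LEAST k. (k \<in> I) \<noteq> (k \<in> L))"
    obtain k where k: "(k \<in> I) \<noteq> (k \<in> L)" using ne by auto
    have d: "(d \<in> I) \<noteq> (d \<in> L)"
      unfolding d_def using LeastI[of "\<lambda>k. (k \<in> I) \<noteq> (k \<in> L)", OF k] .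
    have le: "\<forall>k<d. (k \<in> I) = (k \<in> L)"
      unfolding d_def by (blast dest: not_less_Least)
    have dr: "d \<in> {1..r}" using d A assms by blast
    have "(\<exists>d\<in>{1..r}. (\<forall>k\<in>{1..<d}. k \<in> I \<longleftrightarrow> k \<in> L) \<and> d \<in> I \<and> d \<notin> L) \<or>
        (\<exists>d\<in>{1..r}. (\<forall>k\<in>{1..<d}. k \<in> L \<longleftrightarrow> k \<in> I) \<and> d \<in> L \<and> d \<notin> I)"
    proof (cases "d \<in> I")
      case True
      then show ?thesis using d le dr by (intro disjI1 bexI[of _ d]) simp_all
    next
      case False
      then show ?thesis using d le dr by (intro disjI2 bexI[of _ d]) simp_all
    qed
    then show "index_less r L I \<or> index_less r I L"
      unfolding index_less_iff[OF fin[OF A(1)] fin[OF A(2)]]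
        index_less_iff[OF fin[OF A(2)] fin[OF A(1)]]
      by (meson linorder_neqE_nat)
  qed
qed

lemmas decreasing_listing_sign_vectors =
  is_decreasing_listing_decreasing_listing
    [OF sign_less_order(4) sign_less_order(1) sign_less_order(2) sign_less_order(3)]

lemmas decreasing_listing_index_sets =
  is_decreasing_listing_decreasing_listing
    [OF index_less_order(4) index_less_order(1) index_less_order(2) index_less_order(3)]


section \<open>The facets and their listing\<close>

text \<open>
  The entry of a sign vector \<open>\<nu>\<close> at position \<open>p\<close> is the sign belonging to the \<open>p\<close>-th index
  pair in the enumeration \<open>ps\<close>.
\<close>

definition sign_part :: "(nat \<times> nat) list \<Rightarrow> sign list \<Rightarrow> cw_label set" where
  "sign_part ps \<nu> = {Wv (\<nu> ! p) (fst (ps ! p)) (snd (ps ! p)) | p. p < length ps}"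

definition is_pair_ordering :: "(nat \<Rightarrow> nat) \<Rightarrow> nat set \<Rightarrow> (nat \<times> nat) list \<Rightarrow> bool" where
  "is_pair_ordering t S ps \<longleftrightarrow> distinct ps \<and> set ps = {(i, j). i \<in> S \<and> j \<in> {1..t i}}"

definition facet_F :: "nat \<Rightarrow> nat \<Rightarrow> nat \<Rightarrow> (nat \<Rightarrow> nat) \<Rightarrow> nat set \<Rightarrow> (nat \<times> nat) list \<Rightarrow>
    sign list \<Rightarrow> cw_label set" where
  "facet_F n m m' f I ps \<nu> =
     {Yv j | j. j \<in> {m'+1..m}} \<union> {Zv k l | k l. k \<in> {1..n} \<and> l \<in> {1..f k}} \<union>
     {Yv i | i. i \<in> I} \<union> sign_part ps \<nu>"

definition facet_G :: "nat \<Rightarrow> (nat \<Rightarrow> nat) \<Rightarrow> nat set \<Rightarrow> (nat \<times> nat) list \<Rightarrow>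
    sign list \<Rightarrow> cw_label set" where
  "facet_G n f J ps \<nu> =
     {Xv j | j. j \<in> J} \<union> {Zv k l | k l. k \<in> {1..n} - J \<and> l \<in> {1..f k}} \<union> sign_part ps \<nu>"

definition family_F_list :: "nat \<Rightarrow> nat \<Rightarrow> nat \<Rightarrow> (nat \<Rightarrow> nat) \<Rightarrow> (nat \<Rightarrow> nat) \<Rightarrow>
    (nat set \<Rightarrow> (nat \<times> nat) list) \<Rightarrow> nat set \<Rightarrow> cw_label set list" where
  "family_F_list n m m' f t ordF I =
     map (facet_F n m m' f I (ordF I))
       (decreasing_listing sign_less (sign_vectors (\<Sum>i\<in>{1..m'} - I. t i)))"

definition family_G_list :: "nat \<Rightarrow> nat \<Rightarrow> (nat \<Rightarrow> nat) \<Rightarrow> (nat \<Rightarrow> nat) \<Rightarrow>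
    (nat set \<Rightarrow> (nat \<times> nat) list) \<Rightarrow> nat set \<Rightarrow> cw_label set list" where
  "family_G_list n m f t ordG J =
     map (facet_G n f J (ordG J))
       (decreasing_listing sign_less (sign_vectors (\<Sum>j\<in>{1..m}. t j)))"

definition facet_listing :: "nat \<Rightarrow> nat \<Rightarrow> nat \<Rightarrow> (nat \<Rightarrow> nat) \<Rightarrow> (nat \<Rightarrow> nat) \<Rightarrow>
    (nat set \<Rightarrow> (nat \<times> nat) list) \<Rightarrow> (nat set \<Rightarrow> (nat \<times> nat) list) \<Rightarrow> cw_label set list" where
  "facet_listing n m m' f t ordF ordG =
     concat (map (family_F_list n m m' f t ordF)
       (decreasing_listing (index_less m') (Pow {1..m'}))) @
     concat (map (family_G_list n m f t ordG)
       (decreasing_listing (index_less n) (Pow {1..n} - {{}})))"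

end

theory Submission
  imports Defs
begin

text \<open>
  A listing of the facets is a shelling as soon as, for every facet $F$ and every earlier facet
  $A$, there are an earlier facet $C$ and a vertex $v \in F \setminus A$ with
  $C \cap F = F \setminus \{v\}$: the faces that $F$ shares with earlier facets then all lie in
  ridges of $F$ that are themselves shared. This is the condition \<open>shells_over\<close>. It also forces
  the listing to be free of repetitions, because no vertex of $F$ is missing from $F$.

  For the listing at hand the pair $(C, v)$ is found as follows.

  \<^item> If $A$ and $F$ lie in the same family, the order on sign vectors gives $A$ a $+$ at some
    position where $F$ has a $-$. Take for $v$ that vertex $w^-$ and for $C$ the facet with
    $w^+$ in its place; it has one more $+$, hence is earlier (\<open>shells_over_sign_family\<close>).

  \<^item> If $F \in \mathcal{F}_I$ and $A \in \mathcal{F}_L$ with $L$ before $I$, then $I \not\subseteq L$,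
    and for $i \in I \setminus L$ one takes $v = y_i$ and $C \in \mathcal{F}_{I \setminus \{i\}}$ with
    the same signs as $F$ wherever both have signs (\<open>attaches_F\<close>).

  \<^item> If $F \in \mathcal{G}_J$ and $A$ lies in some $\mathcal{F}_I$ or in an earlier
    $\mathcal{G}_L$, there is $j \in J$ with $x_j \notin A$. Take $v = x_j$ and
    $C \in \mathcal{G}_{J \setminus \{j\}}$; when $J = \{j\}$ the role of the nonexistent
    $\mathcal{G}_\emptyset$ is played by $\mathcal{F}_\emptyset$ (\<open>attaches_G\<close>).

  That the listed sets are exactly the maximal independent sets depends on completeness of the
  bipartite graph: an independent set containing some $x_k$ contains no $y_j$ at all, so it is
  governed by its set $J$ of $x$-vertices, and otherwise by its set $I$ of $y$-vertices.
  Everything is proved for the labelled model graph, and the criterion and the facets are then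
  transported along the isomorphism.
\<close>

section \<open>A combinatorial criterion for shellings\<close>

text \<open>
  For \<open>P\<close> the set of earlier facets, this says that the common faces of \<open>F\<close> with \<open>P\<close> are
  generated by ridges of \<open>F\<close>, in a form that mentions vertices only and is hence
  preserved by injective maps of the vertices.
\<close>

definition attaches :: "'a set set \<Rightarrow> 'a set \<Rightarrow> bool" where
  "attaches P F \<longleftrightarrow> (\<forall>A\<in>P. \<exists>C\<in>P. \<exists>v\<in>F. v \<notin> A \<and> C \<inter> F = F - {v})"

text \<open>
  The set \<open>P\<close> of facets that are already present is a parameter so that a concatenation of
  families can be treated one family at a time.
\<close>

fun shells_over :: "'a set set \<Rightarrow> 'a set list \<Rightarrow> bool" where
  "shells_over P [] \<longleftrightarrow> True"
| "shells_over P (F # Fs) \<longleftrightarrow> attaches P F \<and> shells_over (insert F P) Fs"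

lemma attaches_Un: "attaches P F \<Longrightarrow> attaches Q F \<Longrightarrow> attaches (P \<union> Q) F"
  unfolding attaches_def ball_Un by (simp add: bex_Un)

lemma attaches_not_mem: "attaches P F \<Longrightarrow> F \<notin> P"
  unfolding attaches_def by auto

lemma shells_over_append:
  "shells_over P (xs @ ys) \<longleftrightarrow> shells_over P xs \<and> shells_over (P \<union> set xs) ys"
  by (induction xs arbitrary: P) simp_all

lemma shells_overI:
  assumes "\<And>as F bs. Fs = as @ F # bs \<Longrightarrow> attaches (P \<union> set as) F"
  shows "shells_over P Fs"
  using assms
proof (induction Fs arbitrary: P)
  case (Cons F Fs)
  have "attaches P F" using Cons.prems[of "[]" F Fs] by simp
  moreover have "shells_over (insert F P) Fs"
  proof (rule Cons.IH)
    fix as E bs assume "Fs = as @ E # bs"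
    then show "attaches (insert F P \<union> set as) E"
      using Cons.prems[of "F # as" E bs] by simp
  qed
  ultimately show ?case by simp
qed simp

lemma shells_over_concat:
  assumes "\<And>as x bs. xs = as @ x # bs \<Longrightarrow> shells_over (P \<union> (\<Union>y\<in>set as. set (g y))) (g x)"
  shows "shells_over P (concat (map g xs))"
  using assms
proof (induction xs arbitrary: P)
  case (Cons x xs)
  have "shells_over P (g x)" using Cons.prems[of "[]" x xs] by simp
  moreover have "shells_over (P \<union> set (g x)) (concat (map g xs))"
  proof (rule Cons.IH)
    fix as y bs assume "xs = as @ y # bs"
    then show "shells_over ((P \<union> set (g x)) \<union> (\<Union>y\<in>set as. set (g y))) (g y)"
      using Cons.prems[of "x # as" y bs] by (simp add: Un_assoc)
  qed
  ultimately show ?case by (simp add: shells_over_append)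
qed simp

lemma shells_over_attaches_nth:
  assumes "shells_over {} Fs" "i < length Fs"
  shows "attaches (set (take i Fs)) (Fs ! i)"
proof -
  have "shells_over {} (take i Fs @ Fs ! i # drop (Suc i) Fs)"
    using assms by (simp add: id_take_nth_drop[symmetric])
  then show ?thesis by (simp add: shells_over_append)
qed

lemma shells_over_distinct: "shells_over P Fs \<Longrightarrow> distinct Fs \<and> set Fs \<inter> P = {}"
proof (induction Fs arbitrary: P)
  case (Cons F Fs)
  then have F: "attaches P F" and "distinct Fs \<and> set Fs \<inter> insert F P = {}"
    using Cons.IH[of "insert F P"] by simp_all
  then show ?case using attaches_not_mem[OF F] by auto
qed simp

lemma attaches_image:
  assumes "inj_on h V" "F \<subseteq> V" "\<Union>P \<subseteq> V" "attaches P F"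
  shows "attaches (image h ` P) (h ` F)"
  unfolding attaches_def
proof safe
  fix A assume A: "A \<in> P"
  then obtain C v where C: "C \<in> P" "v \<in> F" "v \<notin> A" "C \<inter> F = F - {v}"
    using assms(4) unfolding attaches_def by meson
  have sub: "A \<subseteq> V" "C \<subseteq> V" using A C(1) assms(3) by auto
  have "h v \<notin> h ` A" using C sub assms(1,2) by (meson inj_on_image_mem_iff subsetD)
  moreover have "h ` C \<inter> h ` F = h ` (C \<inter> F)"
    using inj_on_image_Int[OF assms(1) sub(2) assms(2)] by simp
  moreover have "h ` (F - {v}) = h ` F - {h v}"
    using inj_on_image_set_diff[OF assms(1), of F "{v}"] C(2) assms(2) by auto
  ultimately show "\<exists>D\<in>image h ` P. \<exists>w\<in>h ` F. w \<notin> h ` A \<and> D \<inter> h ` F = h ` F - {w}"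
    using C by auto
qed

lemma shells_over_image:
  assumes "inj_on h V" "\<Union>(set Fs) \<subseteq> V" "\<Union>P \<subseteq> V" "shells_over P Fs"
  shows "shells_over (image h ` P) (map (image h) Fs)"
  using assms(2-4)
proof (induction Fs arbitrary: P)
  case (Cons F Fs)
  have "attaches (image h ` P) (h ` F)"
    using Cons.prems by (intro attaches_image[OF assms(1)]) simp_all
  moreover have "shells_over (image h ` insert F P) (map (image h) Fs)"
    using Cons.prems by (intro Cons.IH) simp_all
  ultimately show ?case by simp
qed simp

text \<open>
  The hypothesis rewrites the intersection as the union of the simplices spanned by the ridges
  $F \setminus \{v\}$ for $v$ in a set $W$. Its facets are therefore among those ridges, and $W$ is
  nonempty because \<open>P\<close> is.
\<close>

lemma attaches_pure:
  assumes "attaches P F" "P \<noteq> {}" "finite F"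
  defines "L \<equiv> (\<Union>C\<in>P. Pow C) \<inter> Pow F"
  shows "pure_complex L" "complex_dim L = face_dim F - 1"
proof -
  define W where "W = {v\<in>F. \<exists>C\<in>P. C \<inter> F = F - {v}}"
  have L: "L = (\<Union>v\<in>W. Pow (F - {v}))"
  proof (rule set_eqI)
    fix s show "s \<in> L \<longleftrightarrow> s \<in> (\<Union>v\<in>W. Pow (F - {v}))"
    proof
      assume "s \<in> L"
      then obtain A where A: "A \<in> P" "s \<subseteq> A" "s \<subseteq> F" unfolding L_def by blast
      then obtain C v where "C \<in> P" "v \<in> F" "v \<notin> A" "C \<inter> F = F - {v}"
        using assms(1) unfolding attaches_def by meson
      then have "v \<in> W" "s \<subseteq> F - {v}" using A unfolding W_def by auto
      then show "s \<in> (\<Union>v\<in>W. Pow (F - {v}))" by blast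
    next
      assume "s \<in> (\<Union>v\<in>W. Pow (F - {v}))"
      then obtain v C where "s \<subseteq> F - {v}" "C \<in> P" "C \<inter> F = F - {v}"
        unfolding W_def by auto
      then have "s \<subseteq> C \<inter> F" "C \<in> P" by simp_all
      then show "s \<in> L" unfolding L_def by auto
    qed
  qed
  obtain A where "A \<in> P" using assms(2) by auto
  then obtain C w where "C \<in> P" "w \<in> F" "C \<inter> F = F - {w}"
    using assms(1) unfolding attaches_def by meson
  then have w: "w \<in> W" unfolding W_def by auto
  have fin: "finite L" unfolding L_def using assms(3) by simp
  have dim: "face_dim (F - {v}) = face_dim F - 1" if "v \<in> W" for v
  proof -
    have "v \<in> F" using that by (simp add: W_def)
    then have "Suc (card (F - {v})) = card F" using assms(3) by (intro card_Suc_Diff1)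
    then show ?thesis unfolding face_dim_def by linarith
  qed
  have mono: "face_dim s \<le> face_dim t" if "s \<subseteq> t" "t \<subseteq> F" for s t
    using card_mono[OF finite_subset[OF that(2) assms(3)] that(1)] by (simp add: face_dim_def)
  show cd: "complex_dim L = face_dim F - 1"
    unfolding complex_dim_def
  proof (rule Max_eqI)
    fix y assume "y \<in> face_dim ` L"
    then obtain s v where "y = face_dim s" "s \<subseteq> F - {v}" "v \<in> W" using L by auto
    then show "y \<le> face_dim F - 1" using mono[of s "F - {v}"] dim by auto
  next
    have "F - {w} \<in> L" using L w by auto
    then show "face_dim F - 1 \<in> face_dim ` L" using dim[OF w] by (metis imageI)
  qed (use fin in simp)
  have "face_dim E = face_dim F - 1" if E: "E \<in> facets L" for E
  proof -
    obtain v where v: "v \<in> W" "E \<subseteq> F - {v}" using E L unfolding facets_def by auto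
    then have "F - {v} \<in> L" using L by auto
    then have "F - {v} = E" using E v unfolding facets_def by auto
    then show ?thesis using dim[OF v(1)] by simp
  qed
  moreover have "simplicial_complex L"
    unfolding simplicial_complex_def
  proof (intro conjI ballI allI impI)
    show "L \<noteq> {}" using L w by auto
  next
    fix s assume "s \<in> L"
    then show "finite s" using assms(3) finite_subset unfolding L_def by blast
  next
    fix s r assume "s \<in> L" "r \<subseteq> s"
    then show "r \<in> L" unfolding L_def by blast
  qed (rule fin)
  ultimately show "pure_complex L" unfolding pure_complex_def cd by blast
qed

lemma shelling_if_shells_over:
  assumes "simplicial_complex K" "set Fs = facets K" "shells_over {} Fs"
  shows "shelling K Fs"
proof -
  have "pure_complex ((\<Union>j<i. Pow (Fs ! j)) \<inter> Pow (Fs ! i)) \<and>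
      complex_dim ((\<Union>j<i. Pow (Fs ! j)) \<inter> Pow (Fs ! i)) = face_dim (Fs ! i) - 1"
    if i: "0 < i" "i < length Fs" for i
  proof -
    have "set (take i Fs) = (!) Fs ` {..<i}"
      using nth_image[of i Fs] i by (simp add: atLeast0LessThan)
    then have U: "(\<Union>j<i. Pow (Fs ! j)) = (\<Union>C\<in>set (take i Fs). Pow C)"
      by simp
    have "Fs ! i \<in> K" using i assms(2) nth_mem unfolding facets_def by blast
    then have fin: "finite (Fs ! i)" using assms(1) unfolding simplicial_complex_def by blast
    have ne: "set (take i Fs) \<noteq> {}" using i by auto
    show ?thesis
      unfolding U using attaches_pure[OF shells_over_attaches_nth[OF assms(3) i(2)] ne fin] by blast
  qed
  then show ?thesis
    using assms shells_over_distinct[OF assms(3)] unfolding shelling_def Let_def by blast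
qed

section \<open>Independence complexes and graph isomorphisms\<close>

lemma independence_complex_iff:
  "\<sigma> \<in> clique_complex (complement_graph G) \<longleftrightarrow>
     finite \<sigma> \<and> \<sigma> \<subseteq> pverts G \<and> (\<forall>u\<in>\<sigma>. \<forall>v\<in>\<sigma>. u \<noteq> v \<longrightarrow> (u, v) \<notin> parcs G)"
  unfolding clique_complex_def complement_graph_def by auto

lemma independence_complex_simplicial:
  assumes "finite (pverts G)"
  shows "simplicial_complex (clique_complex (complement_graph G))"
proof -
  have "clique_complex (complement_graph G) \<subseteq> Pow (pverts G)"
    by (auto simp: independence_complex_iff)
  then have "finite (clique_complex (complement_graph G))"
    using assms by (meson finite_Pow_iff finite_subset)
  moreover have "{} \<in> clique_complex (complement_graph G)"
    by (simp add: independence_complex_iff)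
  moreover have "r \<in> clique_complex (complement_graph G)"
    if "s \<in> clique_complex (complement_graph G)" "r \<subseteq> s" for r s
  proof -
    have "finite r" using that finite_subset[of r s] by (simp add: independence_complex_iff)
    then show ?thesis using that by (auto simp: independence_complex_iff)
  qed
  moreover have "finite s" if "s \<in> clique_complex (complement_graph G)" for s
    using that by (simp add: independence_complex_iff)
  ultimately show ?thesis
    unfolding simplicial_complex_def by blast
qed

lemma independence_complex_isomorphism:
  assumes "graph_isomorphism h H G"
  shows "clique_complex (complement_graph G) = image h ` clique_complex (complement_graph H)"
proof (rule set_eqI)
  have inj: "inj_on h (pverts H)" and img: "h ` pverts H = pverts G"
    and arcs: "\<And>u v. u \<in> pverts H \<Longrightarrow> v \<in> pverts H \<Longrightarrow> (u, v) \<in> parcs H \<longleftrightarrow> (h u, h v) \<in> parcs G"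
    using assms unfolding graph_isomorphism_def bij_betw_def by auto
  have key: "h ` \<tau> \<in> clique_complex (complement_graph G) \<longleftrightarrow>
      \<tau> \<in> clique_complex (complement_graph H)" if "\<tau> \<subseteq> pverts H" for \<tau>
  proof -
    have "finite (h ` \<tau>) \<longleftrightarrow> finite \<tau>"
      using inj_on_subset[OF inj that] by (rule finite_image_iff)
    moreover have "h ` \<tau> \<subseteq> pverts G" using that img by auto
    moreover have "h u = h v \<longleftrightarrow> u = v" "(h u, h v) \<in> parcs G \<longleftrightarrow> (u, v) \<in> parcs H"
      if "u \<in> \<tau>" "v \<in> \<tau>" for u v
      using that \<open>\<tau> \<subseteq> pverts H\<close> arcs[of u v] inj by (auto dest: inj_onD)
    ultimately show ?thesis using that unfolding independence_complex_iff by simp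
  qed
  fix \<sigma>
  show "\<sigma> \<in> clique_complex (complement_graph G) \<longleftrightarrow>
      \<sigma> \<in> image h ` clique_complex (complement_graph H)"
  proof
    assume s: "\<sigma> \<in> clique_complex (complement_graph G)"
    then have "\<sigma> \<subseteq> h ` pverts H" using img by (simp add: independence_complex_iff)
    then obtain \<tau> where "\<tau> \<subseteq> pverts H" "\<sigma> = h ` \<tau>" by (auto simp: subset_image_iff)
    then show "\<sigma> \<in> image h ` clique_complex (complement_graph H)" using key s by blast
  next
    assume "\<sigma> \<in> image h ` clique_complex (complement_graph H)"
    then obtain \<tau> where "\<tau> \<in> clique_complex (complement_graph H)" "\<sigma> = h ` \<tau>" by blast
    moreover from this have "\<tau> \<subseteq> pverts H" by (simp add: independence_complex_iff)
    ultimately show "\<sigma> \<in> clique_complex (complement_graph G)" using key by simp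
  qed
qed

lemma facets_image:
  assumes "inj_on h V" "\<Union>K \<subseteq> V"
  shows "facets (image h ` K) = image h ` facets K"
proof -
  have eq: "h ` A = h ` B \<longleftrightarrow> A = B" if "A \<in> K" "B \<in> K" for A B
    using that assms by (intro inj_on_image_eq_iff) auto
  have sub: "h ` A \<subseteq> h ` B \<longleftrightarrow> A \<subseteq> B" if AB: "A \<in> K" "B \<in> K" for A B
  proof
    assume le: "h ` A \<subseteq> h ` B"
    show "A \<subseteq> B"
    proof
      fix x assume x: "x \<in> A"
      have V: "B \<subseteq> V" "x \<in> V" using AB x assms(2) by auto
      have "h x \<in> h ` B" using le x by auto
      then show "x \<in> B" using inj_on_image_mem_iff[OF assms(1) V(2,1)] by simp
    qed
  qed (rule image_mono)
  have "h ` F \<in> facets (image h ` K) \<longleftrightarrow> F \<in> facets K" if "F \<in> K" for F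
    unfolding facets_def using that by (auto simp: eq sub)
  moreover have "facets (image h ` K) \<subseteq> image h ` K" "facets K \<subseteq> K"
    unfolding facets_def by blast+
  ultimately show ?thesis by blast
qed

lemma facets_eqI:
  assumes "\<S> \<subseteq> K"
    and "\<And>\<sigma>. \<sigma> \<in> K \<Longrightarrow> \<exists>F\<in>\<S>. \<sigma> \<subseteq> F"
    and "\<And>F \<sigma>. F \<in> \<S> \<Longrightarrow> \<sigma> \<in> K \<Longrightarrow> F \<subseteq> \<sigma> \<Longrightarrow> \<sigma> \<subseteq> F"
  shows "\<S> = facets K"
proof
  show "\<S> \<subseteq> facets K"
  proof
    fix F assume F: "F \<in> \<S>"
    then have "\<sigma> = F" if "\<sigma> \<in> K" "F \<subseteq> \<sigma>" for \<sigma> using that assms(3)[OF F] by auto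
    then show "F \<in> facets K" using F assms(1) unfolding facets_def by auto
  qed
  show "facets K \<subseteq> \<S>"
  proof
    fix \<sigma> assume \<sigma>: "\<sigma> \<in> facets K"
    then have "\<sigma> \<in> K" unfolding facets_def by simp
    then obtain F where F: "F \<in> \<S>" "\<sigma> \<subseteq> F" using assms(2)[of \<sigma>] by blast
    moreover have "F \<in> K" using F(1) assms(1) by auto
    ultimately have "F = \<sigma>" using \<sigma> unfolding facets_def by simp
    then show "\<sigma> \<in> \<S>" using F by simp
  qed
qed

section \<open>Predecessors in the two orders\<close>

lemma decreasing_listing_before:
  assumes "is_decreasing_listing lt A (as @ x # bs)" "asymp_on A lt"
  shows "set as = {y\<in>A. lt x y}"
proof -
  have A: "A = set as \<union> {x} \<union> set bs"
    using assms(1) by (auto simp: is_decreasing_listing_def)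
  have "\<forall>y\<in>set as. lt x y" "\<forall>y\<in>set bs. lt y x"
    using assms(1) by (auto simp: is_decreasing_listing_def sorted_wrt_append)
  then show ?thesis using A assms(2) by (auto dest: asymp_onD)
qed

text \<open>
  Here \<open>L\<close> comes before \<open>J\<close> in a decreasing listing: it is smaller, or of the same size and
  different.
\<close>

lemma not_subset_if_index_less:
  assumes "index_less r J L" "finite J" "finite L"
  shows "\<not> J \<subseteq> L"
proof
  assume "J \<subseteq> L"
  moreover have "card L \<le> card J" using assms by (auto simp: index_less_iff)
  ultimately have "J = L" using card_seteq[OF assms(3)] by blast
  then show False using assms by (auto simp: index_less_iff)
qed

lemma index_less_remove: "finite J \<Longrightarrow> j \<in> J \<Longrightarrow> index_less r J (J - {j})"
  unfolding index_less_def using card_Diff1_less[of J j] by simp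

lemma count_list_conv_card: "count_list xs x = card {p. p < length xs \<and> xs ! p = x}"
  by (auto simp: count_list_eq_length_filter length_filter_conv_card intro!: arg_cong[of _ _ card])

text \<open>
  Comparing the position sets of the $+$ signs: that of \<open>\<omega>\<close> has at least as many elements as
  that of \<open>\<nu>\<close> and differs from it, so it is not a subset. Setting a $-$ of \<open>\<nu>\<close> to $+$ raises
  the number of $+$ signs and thus gives a larger vector, whatever the positions are.
\<close>

lemma sign_less_flip:
  assumes "sign_less \<nu> \<omega>" "length \<omega> = length \<nu>"
  obtains p where "p < length \<nu>" "\<nu> ! p = Minus" "\<omega> ! p = Plus" "sign_less \<nu> (\<nu>[p := Plus])"
proof -
  let ?P = "\<lambda>xs. {p. p < length xs \<and> xs ! p = Plus}"
  have "\<not> ?P \<omega> \<subseteq> ?P \<nu>"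
  proof
    assume sub: "?P \<omega> \<subseteq> ?P \<nu>"
    have "card (?P \<nu>) \<le> card (?P \<omega>)"
      using assms(1) unfolding sign_less_def count_list_conv_card by auto
    then have eq: "?P \<omega> = ?P \<nu>" using card_seteq[OF _ sub] by simp
    then obtain d where "d < length \<nu>" "\<nu> ! d = Plus" "\<omega> ! d = Minus"
      using assms(1) unfolding sign_less_def count_list_conv_card by auto
    then show False using eq by (metis (mono_tags, lifting) mem_Collect_eq sign.distinct(1))
  qed
  then obtain p where p: "p < length \<nu>" "\<omega> ! p = Plus" "\<nu> ! p \<noteq> Plus"
    using assms(2) by auto
  then have "?P (\<nu>[p := Plus]) = insert p (?P \<nu>)" by (auto simp: nth_list_update)
  then have "sign_less \<nu> (\<nu>[p := Plus])"
    using p unfolding sign_less_def count_list_conv_card by simp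
  then show thesis using that p by (metis sign.exhaust)
qed

section \<open>Families of facets indexed by sign vectors\<close>

lemma Wv_in_sign_part_map [simp]:
  "Wv e j l \<in> sign_part ps (map \<epsilon> ps) \<longleftrightarrow> (j, l) \<in> set ps \<and> e = \<epsilon> (j, l)"
  unfolding sign_part_def by (force simp: in_set_conv_nth)

lemma not_in_sign_part [simp]:
  "Xv k \<notin> sign_part ps \<nu>" "Yv k \<notin> sign_part ps \<nu>" "Zv k l \<notin> sign_part ps \<nu>"
  unfolding sign_part_def by auto

text \<open>
  Different families enumerate their index pairs differently, so their sign vectors cannot be
  compared entry by entry. Replacing a vector by a function \<open>\<epsilon>\<close> on index pairs
  removes the enumeration: the same \<open>\<epsilon>\<close> can be used in two families to get matching signs.
\<close>

lemma sign_vector_eq_map: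
  assumes "distinct ps" "length \<nu> = length ps"
  obtains \<epsilon> where "\<nu> = map \<epsilon> ps"
proof
  show "\<nu> = map (the \<circ> map_of (zip ps \<nu>)) ps"
    using assms by (intro nth_equalityI) (simp_all add: map_of_zip_nth)
qed

lemma set_sign_family:
  assumes "distinct ps" "length ps = s"
  shows "set (map g (decreasing_listing sign_less (sign_vectors s))) = range (\<lambda>\<epsilon>. g (map \<epsilon> ps))"
proof -
  have "set (decreasing_listing sign_less (sign_vectors s)) = sign_vectors s"
    using decreasing_listing_sign_vectors[of s] unfolding is_decreasing_listing_def by blast
  also have "\<dots> = range (\<lambda>\<epsilon>. map \<epsilon> ps)"
    unfolding sign_vectors_def using assms by (auto elim: sign_vector_eq_map[OF assms(1)])
  finally show ?thesis by (simp add: image_image)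
qed

text \<open>
  For an earlier facet of the same family the witness comes from flipping one $-$ to $+$; for
  the facets \<open>P\<close> of previous families it is supplied by the last hypothesis. The set \<open>B\<close> is
  the part common to the whole family.
\<close>

lemma shells_over_sign_family:
  assumes ps: "distinct ps" "length ps = s"
    and B: "\<And>e j l. Wv e j l \<notin> B"
    and P: "\<And>\<epsilon>. attaches P (B \<union> sign_part ps (map \<epsilon> ps))"
  shows "shells_over P
    (map (\<lambda>\<nu>. B \<union> sign_part ps \<nu>) (decreasing_listing sign_less (sign_vectors s)))"
proof (rule shells_overI)
  let ?g = "\<lambda>\<nu>. B \<union> sign_part ps \<nu>"
  fix as F bs
  assume "map ?g (decreasing_listing sign_less (sign_vectors s)) = as @ F # bs"
  then obtain us \<nu> vs where dl: "decreasing_listing sign_less (sign_vectors s) = us @ \<nu> # vs"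
    and as: "as = map ?g us" and F: "F = ?g \<nu>"
    by (auto simp: map_eq_append_conv map_eq_Cons_conv)
  have ld: "is_decreasing_listing sign_less (sign_vectors s) (us @ \<nu> # vs)"
    using decreasing_listing_sign_vectors[of s] dl by simp
  have us: "set us = {\<omega>\<in>sign_vectors s. sign_less \<nu> \<omega>}"
    using decreasing_listing_before[OF ld sign_less_order(1)] .
  have \<nu>: "length \<nu> = s" using ld by (auto simp: is_decreasing_listing_def sign_vectors_def)
  have "attaches (set as) F"
    unfolding attaches_def
  proof
    fix A assume "A \<in> set as"
    then obtain \<omega> where \<omega>: "length \<omega> = s" "sign_less \<nu> \<omega>" "A = ?g \<omega>"
      using as us by (auto simp: sign_vectors_def)
    obtain p where p: "p < length \<nu>" "\<nu> ! p = Minus" "\<omega> ! p = Plus" "sign_less \<nu> (\<nu>[p := Plus])"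
      using sign_less_flip[OF \<omega>(2)] \<omega>(1) \<nu> by auto
    let ?C = "?g (\<nu>[p := Plus])"
    \<comment> \<open>The flipped facet contains the \<open>Plus\<close> partner of this vertex in its place.\<close>
    let ?v = "Wv Minus (fst (ps ! p)) (snd (ps ! p))"
    have inj: "ps ! q = ps ! p \<longleftrightarrow> q = p" if "q < length ps" for q
      using that p(1) \<nu> ps by (simp add: nth_eq_iff_index_eq)
    have vq: "?v = Wv (\<rho> ! q) (fst (ps ! q)) (snd (ps ! q)) \<longleftrightarrow> q = p \<and> \<rho> ! p = Minus"
      if "q < length ps" for q \<rho>
      using inj[OF that] by (auto simp: prod_eq_iff)
    have mem: "?v \<in> sign_part ps \<rho> \<longleftrightarrow> \<rho> ! p = Minus" for \<rho>
    proof
      assume "?v \<in> sign_part ps \<rho>"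
      then obtain q where "q < length ps" "?v = Wv (\<rho> ! q) (fst (ps ! q)) (snd (ps ! q))"
        unfolding sign_part_def by blast
      then show "\<rho> ! p = Minus" using vq by blast
    next
      assume "\<rho> ! p = Minus"
      then show "?v \<in> sign_part ps \<rho>"
        using p(1) \<nu> ps(2) unfolding sign_part_def by (auto intro!: exI[of _ p])
    qed
    have "?C \<in> set as" using p(4) \<nu> us as by (auto simp: sign_vectors_def)
    moreover have "?v \<in> F" using mem p(2) F by blast
    moreover have "?v \<notin> A" using mem p(3) \<omega>(3) B by simp
    moreover have "?C \<inter> F = F - {?v}"
    proof (rule set_eqI)
      fix x
      have "x \<in> sign_part ps (\<nu>[p := Plus])" if x: "x \<in> sign_part ps \<nu>" "x \<noteq> ?v"
      proof -
        obtain q where q: "q < length ps" "x = Wv (\<nu> ! q) (fst (ps ! q)) (snd (ps ! q))"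
          using x(1) unfolding sign_part_def by blast
        then have "q \<noteq> p" using x(2) p(2) by auto
        then show ?thesis using q unfolding sign_part_def by (auto intro!: exI[of _ q])
      qed
      moreover have "?v \<notin> ?C" using mem p(1) B by simp
      ultimately show "x \<in> ?C \<inter> F \<longleftrightarrow> x \<in> F - {?v}" using F B by blast
    qed
    ultimately show "\<exists>C\<in>set as. \<exists>v\<in>F. v \<notin> A \<and> C \<inter> F = F - {v}" by (meson bexI)
  qed
  moreover obtain \<epsilon> where "\<nu> = map \<epsilon> ps" using sign_vector_eq_map ps \<nu> by metis
  ultimately show "attaches (P \<union> set as) F" using P F attaches_Un by metis
qed

section \<open>The listing for a complete bipartite supporting graph\<close>

locale complete_bipartite_cw =
  fixes n m m' :: nat and f t :: "nat \<Rightarrow> nat"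
    and ordF ordG :: "nat set \<Rightarrow> (nat \<times> nat) list"
  assumes m': "m' \<le> m"
    and f: "k \<in> {1..n} \<Longrightarrow> f k \<ge> 1"
    and t: "j \<in> {1..m} \<Longrightarrow> t j \<ge> 1 \<longleftrightarrow> j \<le> m'"
    and ordF: "I \<subseteq> {1..m'} \<Longrightarrow> is_pair_ordering t ({1..m'} - I) (ordF I)"
    and ordG: "J \<subseteq> {1..n} \<Longrightarrow> J \<noteq> {} \<Longrightarrow> is_pair_ordering t {1..m'} (ordG J)"
begin

abbreviation "H \<equiv> cw_graph n m (complete_bipartite_edges n m) f t"

text \<open>
  The facets of a family are parametrised by sign functions on index pairs, so that facets of
  different families can be given matching signs by one and the same function.
\<close>

abbreviation "FF I \<epsilon> \<equiv> facet_F n m m' f I (ordF I) (map \<epsilon> (ordF I))"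

abbreviation "GG J \<epsilon> \<equiv> facet_G n f J (ordG J) (map \<epsilon> (ordG J))"

lemma length_pair_ordering:
  assumes "is_pair_ordering t S ps" "finite S"
  shows "length ps = (\<Sum>i\<in>S. t i)"
proof -
  have "set ps = Sigma S (\<lambda>i. {1..t i})" using assms(1) unfolding is_pair_ordering_def by auto
  moreover have "distinct ps" using assms(1) unfolding is_pair_ordering_def by blast
  ultimately show ?thesis using assms(2) distinct_card[of ps] by simp
qed

lemma ordF_facts:
  assumes "I \<subseteq> {1..m'}"
  shows "distinct (ordF I)" "length (ordF I) = (\<Sum>i\<in>{1..m'} - I. t i)"
    "(j, l) \<in> set (ordF I) \<longleftrightarrow> j \<in> {1..m'} \<and> j \<notin> I \<and> l \<in> {1..t j}"
  using ordF[OF assms] length_pair_ordering[OF ordF[OF assms]]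
  by (auto simp: is_pair_ordering_def)

lemma ordG_facts:
  assumes "J \<subseteq> {1..n}" "J \<noteq> {}"
  shows "distinct (ordG J)" "length (ordG J) = (\<Sum>j\<in>{1..m}. t j)"
    "(j, l) \<in> set (ordG J) \<longleftrightarrow> j \<in> {1..m'} \<and> l \<in> {1..t j}"
proof -
  have "t j = 0" if "j \<in> {1..m} - {1..m'}" for j using t[of j] that by auto
  then have "(\<Sum>j\<in>{1..m'}. t j) = (\<Sum>j\<in>{1..m}. t j)"
    using m' by (intro sum.mono_neutral_left) auto
  then show "length (ordG J) = (\<Sum>j\<in>{1..m}. t j)"
    using length_pair_ordering[OF ordG[OF assms]] by simp
next
  show "distinct (ordG J)" "(j, l) \<in> set (ordG J) \<longleftrightarrow> j \<in> {1..m'} \<and> l \<in> {1..t j}"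
    using ordG[OF assms] by (simp_all add: is_pair_ordering_def)
qed

lemma FF_mem:
  assumes "I \<subseteq> {1..m'}"
  shows "Xv k \<notin> FF I \<epsilon>"
    "Yv j \<in> FF I \<epsilon> \<longleftrightarrow> j \<in> {m'+1..m} \<or> j \<in> I"
    "Zv k l \<in> FF I \<epsilon> \<longleftrightarrow> k \<in> {1..n} \<and> l \<in> {1..f k}"
    "Wv e j l \<in> FF I \<epsilon> \<longleftrightarrow> j \<in> {1..m'} \<and> j \<notin> I \<and> l \<in> {1..t j} \<and> e = \<epsilon> (j, l)"
  unfolding facet_F_def by (auto simp: ordF_facts(3)[OF assms])

lemma GG_mem:
  assumes "J \<subseteq> {1..n}" "J \<noteq> {}"
  shows "Xv k \<in> GG J \<epsilon> \<longleftrightarrow> k \<in> J"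
    "Yv j \<notin> GG J \<epsilon>"
    "Zv k l \<in> GG J \<epsilon> \<longleftrightarrow> k \<in> {1..n} \<and> k \<notin> J \<and> l \<in> {1..f k}"
    "Wv e j l \<in> GG J \<epsilon> \<longleftrightarrow> j \<in> {1..m'} \<and> l \<in> {1..t j} \<and> e = \<epsilon> (j, l)"
  unfolding facet_G_def by (auto simp: ordG_facts(3)[OF assms])

lemma set_family_F_list: "I \<subseteq> {1..m'} \<Longrightarrow> set (family_F_list n m m' f t ordF I) = range (FF I)"
  unfolding family_F_list_def by (intro set_sign_family ordF_facts; assumption)

lemma set_family_G_list:
  "J \<subseteq> {1..n} \<Longrightarrow> J \<noteq> {} \<Longrightarrow> set (family_G_list n m f t ordG J) = range (GG J)"
  unfolding family_G_list_def by (intro set_sign_family ordG_facts; assumption)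

lemma FF_remove:
  assumes "I \<subseteq> {1..m'}" "i \<in> I"
  shows "FF (I - {i}) \<epsilon> \<inter> FF I \<epsilon> = FF I \<epsilon> - {Yv i}"
proof (rule set_eqI)
  have *: "I - {i} \<subseteq> {1..m'}" using assms by auto
  show "x \<in> FF (I - {i}) \<epsilon> \<inter> FF I \<epsilon> \<longleftrightarrow> x \<in> FF I \<epsilon> - {Yv i}" for x
    using assms by (cases x) (auto simp: FF_mem[OF *] FF_mem[OF assms(1)])
qed

lemma GG_remove:
  assumes "J \<subseteq> {1..n}" "j \<in> J" "J - {j} \<noteq> {}"
  shows "GG (J - {j}) \<epsilon> \<inter> GG J \<epsilon> = GG J \<epsilon> - {Xv j}"
proof (rule set_eqI)
  have *: "J - {j} \<subseteq> {1..n}" "J \<noteq> {}" using assms by auto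
  show "x \<in> GG (J - {j}) \<epsilon> \<inter> GG J \<epsilon> \<longleftrightarrow> x \<in> GG J \<epsilon> - {Xv j}" for x
    using assms by (cases x) (auto simp: GG_mem[OF *(1) assms(3)] GG_mem[OF assms(1) *(2)])
qed

text \<open>
  The only $\mathcal{F}$-facets that share a ridge with a facet of some $\mathcal{G}_{\{j\}}$ through
  the removal of $x_j$ come from $\mathcal{F}_\emptyset$, since all the triangle vertices chosen by
  the latter must be present.
\<close>

lemma FF_empty_Int_GG_singleton:
  assumes "j \<in> {1..n}"
  shows "FF {} \<epsilon> \<inter> GG {j} \<epsilon> = GG {j} \<epsilon> - {Xv j}"
proof (rule set_eqI)
  have *: "{j} \<subseteq> {1..n}" "{j} \<noteq> {}" "{} \<subseteq> {1..m'}" using assms by auto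
  show "x \<in> FF {} \<epsilon> \<inter> GG {j} \<epsilon> \<longleftrightarrow> x \<in> GG {j} \<epsilon> - {Xv j}" for x
    using assms by (cases x) (auto simp: GG_mem[OF *(1,2)] FF_mem[OF *(3)])
qed

lemma attaches_F:
  assumes "I \<subseteq> {1..m'}"
  shows "attaches (\<Union>L\<in>{L\<in>Pow {1..m'}. index_less m' I L}. range (FF L)) (FF I \<epsilon>)"
  unfolding attaches_def
proof
  let ?P = "\<Union>L\<in>{L\<in>Pow {1..m'}. index_less m' I L}. range (FF L)"
  fix A assume "A \<in> ?P"
  then obtain L \<delta> where L: "L \<subseteq> {1..m'}" "index_less m' I L" "A = FF L \<delta>" by auto
  have fin: "finite I" "finite L" using assms L(1) finite_subset by blast+
  obtain i where i: "i \<in> I" "i \<notin> L" using not_subset_if_index_less[OF L(2) fin] by auto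
  have "FF (I - {i}) \<epsilon> \<in> ?P" using assms index_less_remove[OF fin(1) i(1)] by blast
  moreover have "Yv i \<in> FF I \<epsilon>" using i FF_mem[OF assms] by simp
  moreover have "Yv i \<notin> A" using i assms FF_mem[OF L(1)] L(3) by auto
  ultimately show "\<exists>C\<in>?P. \<exists>v\<in>FF I \<epsilon>. v \<notin> A \<and> C \<inter> FF I \<epsilon> = FF I \<epsilon> - {v}"
    using FF_remove[OF assms i(1)] by meson
qed

lemma attaches_G:
  assumes J: "J \<subseteq> {1..n}" "J \<noteq> {}"
  shows "attaches ((\<Union>I\<in>Pow {1..m'}. range (FF I)) \<union>
      (\<Union>L\<in>{L\<in>Pow {1..n} - {{}}. index_less n J L}. range (GG L))) (GG J \<epsilon>)"
    (is "attaches ?P _")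
  unfolding attaches_def
proof
  fix A assume A: "A \<in> ?P"
  have fin: "finite J" using J finite_subset by blast
  have "\<exists>j\<in>J. Xv j \<notin> A"
  proof (cases "A \<in> (\<Union>I\<in>Pow {1..m'}. range (FF I))")
    case True
    then show ?thesis using FF_mem J(2) by fastforce
  next
    case False
    then obtain L \<delta> where L: "L \<subseteq> {1..n}" "L \<noteq> {}" "index_less n J L" "A = GG L \<delta>"
      using A by auto
    have "finite L" using L(1) finite_subset by blast
    then obtain j where "j \<in> J" "j \<notin> L" using not_subset_if_index_less[OF L(3) fin] by auto
    then show ?thesis using GG_mem(1)[OF L(1,2)] L(4) by auto
  qed
  then obtain j where j: "j \<in> J" "Xv j \<notin> A" by blast
  have "\<exists>C\<in>?P. C \<inter> GG J \<epsilon> = GG J \<epsilon> - {Xv j}"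
  proof (cases "J - {j} = {}")
    case True
    then have "J = {j}" using j(1) by blast
    then have "FF {} \<epsilon> \<inter> GG J \<epsilon> = GG J \<epsilon> - {Xv j}"
      using FF_empty_Int_GG_singleton[of j \<epsilon>] J(1) by simp
    moreover have "FF {} \<epsilon> \<in> ?P" by blast
    ultimately show ?thesis by (rule bexI)
  next
    case False
    then have "J - {j} \<in> {L\<in>Pow {1..n} - {{}}. index_less n J L}"
      using J(1) index_less_remove[OF fin j(1), of n] by auto
    then have "GG (J - {j}) \<epsilon> \<in> ?P" by blast
    then show ?thesis by (rule bexI[rotated]) (rule GG_remove[OF J(1) j(1) False])
  qed
  moreover have "Xv j \<in> GG J \<epsilon>" using j(1) GG_mem[OF J] by simp
  ultimately show "\<exists>C\<in>?P. \<exists>v\<in>GG J \<epsilon>. v \<notin> A \<and> C \<inter> GG J \<epsilon> = GG J \<epsilon> - {v}"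
    using j(2) by meson
qed

lemma F_index_listing:
  "is_decreasing_listing (index_less m') (Pow {1..m'}) (decreasing_listing (index_less m') (Pow {1..m'}))"
proof -
  have sub: "Pow {1..m'} \<subseteq> Pow {1..m'}" by simp
  show ?thesis by (rule decreasing_listing_index_sets[OF sub sub sub sub])
qed

lemma G_index_listing:
  "is_decreasing_listing (index_less n) (Pow {1..n} - {{}})
     (decreasing_listing (index_less n) (Pow {1..n} - {{}}))"
proof -
  have sub: "Pow {1..n} - {{}} \<subseteq> Pow {1..n}" by auto
  show ?thesis by (rule decreasing_listing_index_sets[OF sub sub sub sub])
qed

lemma set_F_part:
  "set (concat (map (family_F_list n m m' f t ordF)
     (decreasing_listing (index_less m') (Pow {1..m'})))) = (\<Union>I\<in>Pow {1..m'}. range (FF I))"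
  using F_index_listing set_family_F_list by (auto simp: is_decreasing_listing_def)

lemma set_facet_listing:
  "set (facet_listing n m m' f t ordF ordG) =
     (\<Union>I\<in>Pow {1..m'}. range (FF I)) \<union> (\<Union>J\<in>Pow {1..n} - {{}}. range (GG J))"
proof -
  have "set (concat (map (family_G_list n m f t ordG)
      (decreasing_listing (index_less n) (Pow {1..n} - {{}})))) =
      (\<Union>J\<in>Pow {1..n} - {{}}. range (GG J))"
    using G_index_listing set_family_G_list by (auto simp: is_decreasing_listing_def)
  then show ?thesis unfolding facet_listing_def set_append set_F_part by simp
qed

lemma shells_over_F_part:
  "shells_over {} (concat (map (family_F_list n m m' f t ordF)
     (decreasing_listing (index_less m') (Pow {1..m'}))))"
proof (rule shells_over_concat)
  fix as I bs assume dl: "decreasing_listing (index_less m') (Pow {1..m'}) = as @ I # bs"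
  have ld: "is_decreasing_listing (index_less m') (Pow {1..m'}) (as @ I # bs)"
    using F_index_listing dl by simp
  have as: "set as = {L\<in>Pow {1..m'}. index_less m' I L}"
    using decreasing_listing_before[OF ld index_less_order(1)] by simp
  have I: "I \<subseteq> {1..m'}" using ld by (auto simp: is_decreasing_listing_def)
  have P: "{} \<union> (\<Union>L\<in>set as. set (family_F_list n m m' f t ordF L)) =
      (\<Union>L\<in>{L\<in>Pow {1..m'}. index_less m' I L}. range (FF L))"
    unfolding as using set_family_F_list by auto
  have fam: "family_F_list n m m' f t ordF I = map (\<lambda>\<nu>. ({Yv j |j. j \<in> {m' + 1..m}} \<union>
      {Zv k l |k l. k \<in> {1..n} \<and> l \<in> {1..f k}} \<union> {Yv i |i. i \<in> I}) \<union> sign_part (ordF I) \<nu>)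
      (decreasing_listing sign_less (sign_vectors (\<Sum>i\<in>{1..m'} - I. t i)))"
    unfolding family_F_list_def by (simp add: facet_F_def)
  show "shells_over ({} \<union> (\<Union>L\<in>set as. set (family_F_list n m m' f t ordF L)))
      (family_F_list n m m' f t ordF I)"
    unfolding P fam
  proof (rule shells_over_sign_family)
    show "attaches (\<Union>L\<in>{L\<in>Pow {1..m'}. index_less m' I L}. range (FF L))
        (({Yv j |j. j \<in> {m' + 1..m}} \<union> {Zv k l |k l. k \<in> {1..n} \<and> l \<in> {1..f k}} \<union>
          {Yv i |i. i \<in> I}) \<union> sign_part (ordF I) (map \<epsilon> (ordF I)))" for \<epsilon>
      using attaches_F[OF I, of \<epsilon>] by (simp only: facet_F_def)
  qed (use ordF_facts[OF I] in auto)
qed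

lemma shells_over_G_part:
  "shells_over (\<Union>I\<in>Pow {1..m'}. range (FF I)) (concat (map (family_G_list n m f t ordG)
     (decreasing_listing (index_less n) (Pow {1..n} - {{}}))))"
proof (rule shells_over_concat)
  let ?F = "\<Union>I\<in>Pow {1..m'}. range (FF I)"
  fix as J bs assume dl: "decreasing_listing (index_less n) (Pow {1..n} - {{}}) = as @ J # bs"
  have ld: "is_decreasing_listing (index_less n) (Pow {1..n} - {{}}) (as @ J # bs)"
    using G_index_listing dl by simp
  have as: "set as = {L\<in>Pow {1..n} - {{}}. index_less n J L}"
    using decreasing_listing_before[OF ld index_less_order(1)] by auto
  have J: "J \<subseteq> {1..n}" "J \<noteq> {}" using ld by (auto simp: is_decreasing_listing_def)
  have P: "(\<Union>L\<in>set as. set (family_G_list n m f t ordG L)) =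
      (\<Union>L\<in>{L\<in>Pow {1..n} - {{}}. index_less n J L}. range (GG L))"
    unfolding as using set_family_G_list by auto
  have fam: "family_G_list n m f t ordG J = map (\<lambda>\<nu>. ({Xv j |j. j \<in> J} \<union>
      {Zv k l |k l. k \<in> {1..n} - J \<and> l \<in> {1..f k}}) \<union> sign_part (ordG J) \<nu>)
      (decreasing_listing sign_less (sign_vectors (\<Sum>j\<in>{1..m}. t j)))"
    unfolding family_G_list_def by (simp add: facet_G_def)
  show "shells_over (?F \<union> (\<Union>L\<in>set as. set (family_G_list n m f t ordG L)))
      (family_G_list n m f t ordG J)"
    unfolding P fam
  proof (rule shells_over_sign_family)
    show "attaches (?F \<union> (\<Union>L\<in>{L\<in>Pow {1..n} - {{}}. index_less n J L}. range (GG L)))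
        (({Xv j |j. j \<in> J} \<union> {Zv k l |k l. k \<in> {1..n} - J \<and> l \<in> {1..f k}}) \<union>
          sign_part (ordG J) (map \<epsilon> (ordG J)))" for \<epsilon>
      using attaches_G[OF J, of \<epsilon>] by (simp only: facet_G_def)
  qed (use ordG_facts[OF J] in auto)
qed

lemma shells_over_facet_listing: "shells_over {} (facet_listing n m m' f t ordF ordG)"
  unfolding facet_listing_def shells_over_append set_F_part
  using shells_over_F_part shells_over_G_part by simp

lemma H_verts:
  "Xv k \<in> pverts H \<longleftrightarrow> k \<in> {1..n}"
  "Yv j \<in> pverts H \<longleftrightarrow> j \<in> {1..m}"
  "Zv k l \<in> pverts H \<longleftrightarrow> k \<in> {1..n} \<and> l \<in> {1..f k}"
  "Wv e j l \<in> pverts H \<longleftrightarrow> j \<in> {1..m} \<and> l \<in> {1..t j}"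
  unfolding cw_graph_def cw_verts_def by auto

lemma finite_H: "finite (pverts H)"
proof -
  have "pverts H \<subseteq> Xv ` {1..n} \<union> Yv ` {1..m} \<union> (\<lambda>(k, l). Zv k l) ` Sigma {1..n} (\<lambda>k. {1..f k}) \<union>
      (\<lambda>(j, l). Wv Plus j l) ` Sigma {1..m} (\<lambda>j. {1..t j}) \<union>
      (\<lambda>(j, l). Wv Minus j l) ` Sigma {1..m} (\<lambda>j. {1..t j})" (is "_ \<subseteq> ?V")
  proof
    fix x assume "x \<in> pverts H"
    then show "x \<in> ?V"
      by (cases x) (auto simp: H_verts image_iff, metis sign.exhaust)
  qed
  then show ?thesis by (rule finite_subset) simp
qed

lemma H_arcs:
  "(Xv k, Xv k') \<notin> parcs H"
  "(Xv k, Yv j) \<in> parcs H \<longleftrightarrow> k \<in> {1..n} \<and> j \<in> {1..m}"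
  "(Yv j, Xv k) \<in> parcs H \<longleftrightarrow> k \<in> {1..n} \<and> j \<in> {1..m}"
  "(Xv k, Zv k' l) \<in> parcs H \<longleftrightarrow> k = k' \<and> k \<in> {1..n} \<and> l \<in> {1..f k}"
  "(Zv k' l, Xv k) \<in> parcs H \<longleftrightarrow> k = k' \<and> k \<in> {1..n} \<and> l \<in> {1..f k}"
  "(Xv k, Wv e j l) \<notin> parcs H"
  "(Wv e j l, Xv k) \<notin> parcs H"
  "(Yv j, Yv j') \<notin> parcs H"
  "(Yv j, Zv k l) \<notin> parcs H"
  "(Zv k l, Yv j) \<notin> parcs H"
  "(Yv j, Wv e j' l) \<in> parcs H \<longleftrightarrow> j = j' \<and> j \<in> {1..m} \<and> l \<in> {1..t j}"
  "(Wv e j' l, Yv j) \<in> parcs H \<longleftrightarrow> j = j' \<and> j \<in> {1..m} \<and> l \<in> {1..t j}"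
  "(Zv k l, Zv k' l') \<notin> parcs H"
  "(Zv k l, Wv e j l') \<notin> parcs H"
  "(Wv e j l', Zv k l) \<notin> parcs H"
  "(Wv e j l, Wv e' j' l') \<in> parcs H \<longleftrightarrow>
     e \<noteq> e' \<and> j = j' \<and> l = l' \<and> j \<in> {1..m} \<and> l \<in> {1..t j}"
  unfolding cw_graph_def cw_half_arcs_def complete_bipartite_edges_def
  by (auto, (metis sign.exhaust)+)

lemma FF_in_complex:
  assumes I: "I \<subseteq> {1..m'}"
  shows "FF I \<epsilon> \<in> clique_complex (complement_graph H)"
proof -
  have sub: "FF I \<epsilon> \<subseteq> pverts H"
  proof
    fix x assume "x \<in> FF I \<epsilon>"
    then show "x \<in> pverts H" using I m' by (cases x) (auto simp: FF_mem[OF I] H_verts)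
  qed
  have "(u, v) \<notin> parcs H" if "u \<in> FF I \<epsilon>" "v \<in> FF I \<epsilon>" for u v
    using that by (cases u; cases v) (auto simp: FF_mem[OF I] H_arcs)
  then show ?thesis
    using sub finite_subset[OF sub finite_H] by (auto simp: independence_complex_iff)
qed

lemma GG_in_complex:
  assumes J: "J \<subseteq> {1..n}" "J \<noteq> {}"
  shows "GG J \<epsilon> \<in> clique_complex (complement_graph H)"
proof -
  have sub: "GG J \<epsilon> \<subseteq> pverts H"
  proof
    fix x assume "x \<in> GG J \<epsilon>"
    then show "x \<in> pverts H" using J m' by (cases x) (auto simp: GG_mem[OF J] H_verts)
  qed
  have "(u, v) \<notin> parcs H" if "u \<in> GG J \<epsilon>" "v \<in> GG J \<epsilon>" for u v
    using that by (cases u; cases v) (auto simp: GG_mem[OF J] H_arcs)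
  then show ?thesis
    using sub finite_subset[OF sub finite_H] by (auto simp: independence_complex_iff)
qed

text \<open>
  The facets mention triangles at $y_1,\ldots,y_{m'}$ only, whereas the graph is defined with
  $t_j$ triangles at each of $y_1,\ldots,y_m$.
\<close>

lemma triangle_bound: "j \<in> {1..m} \<Longrightarrow> l \<in> {1..t j} \<Longrightarrow> j \<in> {1..m'}"
  using t[of j] by auto

text \<open>
  An independent set contains at most one of $w_{j,l}^+$ and $w_{j,l}^-$, so its triangle vertices
  are compatible with the signs \<open>\<epsilon>\<close> read off from the $w_{j,l}^+$ that it contains; for a triangle
  that it misses the choice \<open>Minus\<close> is arbitrary.
\<close>

lemma face_in_listed_facet:
  assumes \<sigma>: "\<sigma> \<in> clique_complex (complement_graph H)"
  shows "\<exists>F\<in>set (facet_listing n m m' f t ordF ordG). \<sigma> \<subseteq> F"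
proof -
  have V: "x \<in> pverts H" if "x \<in> \<sigma>" for x using that \<sigma> by (auto simp: independence_complex_iff)
  have ind: "(u, v) \<notin> parcs H" if "u \<in> \<sigma>" "v \<in> \<sigma>" "u \<noteq> v" for u v
    using that \<sigma> by (auto simp: independence_complex_iff)
  define \<epsilon> where "\<epsilon> = (\<lambda>(j, l). if Wv Plus j l \<in> \<sigma> then Plus else Minus)"
  have \<epsilon>: "e = \<epsilon> (j, l)" if "Wv e j l \<in> \<sigma>" for e j l
  proof (cases e)
    case Minus
    have "Wv Plus j l \<notin> \<sigma>"
      using ind[of "Wv Plus j l" "Wv Minus j l"] V[OF that] that Minus by (auto simp: H_arcs H_verts)
    then show ?thesis using Minus by (simp add: \<epsilon>_def)
  qed (use that in \<open>simp add: \<epsilon>_def\<close>)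
  define J where "J = {k. Xv k \<in> \<sigma>}"
  have Jn: "J \<subseteq> {1..n}" using V[of "Xv _"] unfolding J_def by (auto simp: H_verts)
  show ?thesis
  proof (cases "J = {}")
    case True
    define I where "I = {i\<in>{1..m'}. Yv i \<in> \<sigma>}"
    have I: "I \<subseteq> {1..m'}" unfolding I_def by auto
    have "x \<in> FF I \<epsilon>" if x: "x \<in> \<sigma>" for x
    proof (cases x)
      case (Xv k)
      then show ?thesis using True x by (auto simp: J_def)
    next
      case (Yv j)
      then show ?thesis using V[OF x] x by (simp add: FF_mem[OF I] H_verts) (auto simp: I_def)
    next
      case (Zv k l)
      then show ?thesis using V[OF x] by (auto simp: FF_mem[OF I] H_verts)
    next
      case (Wv e j l)
      then have jl: "j \<in> {1..m}" "l \<in> {1..t j}" using V[OF x] by (auto simp: H_verts)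
      have "j \<notin> I" using ind[of "Yv j" x] x Wv jl by (auto simp: I_def H_arcs)
      then show ?thesis using Wv jl \<epsilon> x triangle_bound[OF jl] by (simp add: FF_mem[OF I])
    qed
    then show ?thesis using I unfolding set_facet_listing by blast
  next
    case False
    then obtain k0 where k0: "Xv k0 \<in> \<sigma>" "k0 \<in> {1..n}" using Jn unfolding J_def by blast
    have "x \<in> GG J \<epsilon>" if x: "x \<in> \<sigma>" for x
    proof (cases x)
      case (Xv k)
      then show ?thesis using x by (simp add: GG_mem[OF Jn False]) (simp add: J_def)
    next
      case (Yv j)
      then show ?thesis using V[OF x] ind[of "Xv k0" x] x k0 by (auto simp: H_arcs H_verts)
    next
      case (Zv k l)
      then have kl: "k \<in> {1..n}" "l \<in> {1..f k}" using V[OF x] by (auto simp: H_verts)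
      then have "k \<notin> J" using ind[of "Xv k" x] x Zv by (auto simp: J_def H_arcs)
      then show ?thesis using kl Zv by (simp add: GG_mem[OF Jn False])
    next
      case (Wv e j l)
      then have jl: "j \<in> {1..m}" "l \<in> {1..t j}" using V[OF x] by (auto simp: H_verts)
      then show ?thesis using Wv \<epsilon> x triangle_bound[OF jl] by (simp add: GG_mem[OF Jn False])
    qed
    then have "\<sigma> \<subseteq> GG J \<epsilon>" by blast
    moreover have "J \<in> Pow {1..n} - {{}}" using Jn False by simp
    then have "GG J \<epsilon> \<in> set (facet_listing n m m' f t ordF ordG)"
      unfolding set_facet_listing by blast
    ultimately show ?thesis by (rule bexI)
  qed
qed

text \<open>
  Every vertex outside the facet has a neighbour in it: $x_k$ has the leaf $z_{k,1}$, a missing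
  $y_j$ has a vertex of its first triangle, and a missing $w$ is adjacent to $y_j$ or to its
  partner. This is where the positivity of \<open>f k\<close>, and of \<open>t j\<close> for $j \le m'$, enters.
\<close>

lemma FF_maximal:
  assumes I: "I \<subseteq> {1..m'}" and \<sigma>: "\<sigma> \<in> clique_complex (complement_graph H)" "FF I \<epsilon> \<subseteq> \<sigma>"
  shows "\<sigma> \<subseteq> FF I \<epsilon>"
proof
  fix x assume x: "x \<in> \<sigma>"
  then have V: "x \<in> pverts H" using \<sigma> by (auto simp: independence_complex_iff)
  have ind: "(x, v) \<notin> parcs H" if "v \<in> FF I \<epsilon>" "x \<noteq> v" for v
    using that \<sigma> x by (auto simp: independence_complex_iff)
  show "x \<in> FF I \<epsilon>"
  proof (cases x)
    case (Xv k)
    then show ?thesis using ind[of "Zv k 1"] V f[of k] by (auto simp: FF_mem[OF I] H_arcs H_verts)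
  next
    case (Yv j)
    then show ?thesis using ind[of "Wv (\<epsilon> (j, 1)) j 1"] V t[of j]
      by (auto simp: FF_mem[OF I] H_arcs H_verts not_le)
  next
    case (Zv k l)
    then show ?thesis using V by (auto simp: FF_mem[OF I] H_verts)
  next
    case (Wv e j l)
    then have jl: "j \<in> {1..m}" "l \<in> {1..t j}" using V by (auto simp: H_verts)
    note j = triangle_bound[OF jl]
    have "j \<notin> I" using ind[of "Yv j"] Wv jl by (auto simp: FF_mem[OF I] H_arcs)
    moreover from this have "e = \<epsilon> (j, l)"
      using ind[of "Wv (\<epsilon> (j, l)) j l"] Wv jl j by (auto simp: FF_mem[OF I] H_arcs)
    ultimately show ?thesis using Wv jl j by (simp add: FF_mem[OF I])
  qed
qed

text \<open>
  Every vertex outside the facet has a neighbour in it: for all the $y_j$ it is any $x_k$ with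
  $k \in J$, by completeness of the bipartite graph and since $J$ is nonempty.
\<close>

lemma GG_maximal:
  assumes J: "J \<subseteq> {1..n}" "J \<noteq> {}"
    and \<sigma>: "\<sigma> \<in> clique_complex (complement_graph H)" "GG J \<epsilon> \<subseteq> \<sigma>"
  shows "\<sigma> \<subseteq> GG J \<epsilon>"
proof
  fix x assume x: "x \<in> \<sigma>"
  then have V: "x \<in> pverts H" using \<sigma> by (auto simp: independence_complex_iff)
  have ind: "(x, v) \<notin> parcs H" if "v \<in> GG J \<epsilon>" "x \<noteq> v" for v
    using that \<sigma> x by (auto simp: independence_complex_iff)
  show "x \<in> GG J \<epsilon>"
  proof (cases x)
    case (Xv k)
    then show ?thesis using ind[of "Zv k 1"] V f[of k] by (auto simp: GG_mem[OF J] H_arcs H_verts)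
  next
    case (Yv j)
    obtain k where "k \<in> J" using J(2) by blast
    then show ?thesis using ind[of "Xv k"] Yv V J(1) by (auto simp: GG_mem[OF J] H_arcs H_verts)
  next
    case (Zv k l)
    then show ?thesis using ind[of "Xv k"] V by (auto simp: GG_mem[OF J] H_arcs H_verts)
  next
    case (Wv e j l)
    then have jl: "j \<in> {1..m}" "l \<in> {1..t j}" using V by (auto simp: H_verts)
    note j = triangle_bound[OF jl]
    have "e = \<epsilon> (j, l)"
      using ind[of "Wv (\<epsilon> (j, l)) j l"] Wv jl j by (auto simp: GG_mem[OF J] H_arcs)
    then show ?thesis using Wv jl j by (simp add: GG_mem[OF J])
  qed
qed

lemma set_facet_listing_eq_facets:
  "set (facet_listing n m m' f t ordF ordG) = facets (clique_complex (complement_graph H))"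
proof (rule facets_eqI[OF _ face_in_listed_facet])
  show "set (facet_listing n m m' f t ordF ordG) \<subseteq> clique_complex (complement_graph H)"
    unfolding set_facet_listing using FF_in_complex GG_in_complex by auto
  fix F \<sigma>
  assume F: "F \<in> set (facet_listing n m m' f t ordF ordG)"
    and \<sigma>: "\<sigma> \<in> clique_complex (complement_graph H)" "F \<subseteq> \<sigma>"
  consider I \<epsilon> where "I \<subseteq> {1..m'}" "F = FF I \<epsilon>"
    | J \<epsilon> where "J \<subseteq> {1..n}" "J \<noteq> {}" "F = GG J \<epsilon>"
    using F unfolding set_facet_listing by blast
  then show "\<sigma> \<subseteq> F"
  proof cases
    case 1
    then show ?thesis using FF_maximal \<sigma> by simp
  next
    case 2
    then show ?thesis using GG_maximal \<sigma> by simp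
  qed
qed

end

theorem proposition3p6:
  fixes G :: "'a pair_pre_digraph"
    and lab :: "cw_label \<Rightarrow> 'a"
    and n m m' :: nat
    and f t :: "nat \<Rightarrow> nat"
    and ordF ordG :: "nat set \<Rightarrow> (nat \<times> nat) list"
  assumes "Cameron_Walker G"
    and "n \<ge> 1" and "m \<ge> 1"
    and "graph_isomorphism lab (cw_graph n m (complete_bipartite_edges n m) f t) G"
    and "\<forall>k\<in>{1..n}. f k \<ge> 1"
    and "m' = card {j\<in>{1..m}. t j \<ge> 1}"
    and "\<forall>j\<in>{1..m}. t j \<ge> 1 \<longleftrightarrow> j \<le> m'"
    and "\<forall>I\<subseteq>{1..m'}. is_pair_ordering t ({1..m'} - I) (ordF I)"
    and "\<forall>J\<subseteq>{1..n}. J \<noteq> {} \<longrightarrow> is_pair_ordering t {1..m'} (ordG J)"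
  shows "shelling (clique_complex (complement_graph G))
           (map (image lab) (facet_listing n m m' f t ordF ordG))"
proof -
  have "card {j\<in>{1..m}. t j \<ge> 1} \<le> card {1..m}" by (rule card_mono) auto
  then have m'_le: "m' \<le> m" using assms(6) by simp
  interpret complete_bipartite_cw n m m' f t ordF ordG
  proof (rule complete_bipartite_cw.intro)
    show "f k \<ge> 1" if "k \<in> {1..n}" for k using assms(5) that by (rule bspec)
    show "t j \<ge> 1 \<longleftrightarrow> j \<le> m'" if "j \<in> {1..m}" for j using assms(7) that by (rule bspec)
    show "is_pair_ordering t ({1..m'} - I) (ordF I)" if "I \<subseteq> {1..m'}" for I
      using assms(8) that by simp
    show "is_pair_ordering t {1..m'} (ordG J)" if "J \<subseteq> {1..n}" "J \<noteq> {}" for J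
      using assms(9) that by simp
  qed (fact m'_le)
  let ?K = "clique_complex (complement_graph H)"
  have inj: "inj_on lab (pverts H)" and img: "lab ` pverts H = pverts G"
    using assms(4) unfolding graph_isomorphism_def bij_betw_def by auto
  have K: "\<Union>?K \<subseteq> pverts H" by (auto simp: independence_complex_iff)
  show ?thesis
  proof (rule shelling_if_shells_over)
    show "simplicial_complex (clique_complex (complement_graph G))"
      using finite_H img by (intro independence_complex_simplicial) (metis finite_imageI)
    show "set (map (image lab) (facet_listing n m m' f t ordF ordG)) =
        facets (clique_complex (complement_graph G))"
      unfolding independence_complex_isomorphism[OF assms(4)] facets_image[OF inj K]
      by (simp add: set_facet_listing_eq_facets)
    have "\<Union>(set (facet_listing n m m' f t ordF ordG)) \<subseteq> pverts H"
      using K unfolding set_facet_listing_eq_facets facets_def by auto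
    from shells_over_image[OF inj this _ shells_over_facet_listing]
    show "shells_over {} (map (image lab) (facet_listing n m m' f t ordF ordG))" by simp
  qed
qed

end
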